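(* For every finite word $w$ of length $n$, \[\mathrm{Cl}'(w)\le \frac{n^2}{6}+\frac{n}{6},\] where $\mathrm{Cl}'(w)$ denotes the number of distinct closed factors of $w$ of length at least $2$.
   Context: Words are over an arbitrary finite alphabet. A factor of a word $w$ is a contiguous subword. A border of a finite word $v$ is a proper prefix of $v$ which is also a suffix of $v$. A finite word $v$ is closed if $|v|\le 1$, or if $|v|\ge 2$ and the longest border of $v$ is non-empty and occurs in $v$ exactly twice (as a prefix and as a suffix). $\mathrm{Cl}'(w)$ is the number of distinct words of length at least $2$ that are closed and are factors of $w$. *)

theory Defs
  imports Complex_Main "HOL-Library.Sublist"
begin

definition border :: "'a list \<Rightarrow> 'a list \<Rightarrow> bool" where
  "border u v \<longleftrightarrow> strict_prefix u v \<and> suffix u v"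

definition longest_border :: "'a list \<Rightarrow> 'a list \<Rightarrow> bool" where
  "longest_border u v \<longleftrightarrow> border u v \<and> (\<forall>u'. border u' v \<longrightarrow> length u' \<le> length u)"

(* Occurrences are identified by their (0-based) starting positions; they may overlap. *)
definition occurrences :: "'a list \<Rightarrow> 'a list \<Rightarrow> nat set" where
  "occurrences u v = {i. i + length u \<le> length v \<and> take (length u) (drop i v) = u}"

definition closed_word :: "'a list \<Rightarrow> bool" where
  "closed_word v \<longleftrightarrow>
     length v \<le> 1 \<or>
     (\<exists>u. longest_border u v \<and> u \<noteq> [] \<and> card (occurrences u v) = 2)"

(* sublist is the contiguous factor relation on lists (subseq is the scattered one). *)
definition Cl' :: "'a list \<Rightarrow> nat" where
  "Cl' w = card {v. sublist v w \<and> 2 \<le> length v \<and> closed_word v}"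

end

theory Submission
  imports Defs
begin

text \<open>
  Write \<open>r(u)\<close> for the number of occurrences of \<open>u\<close> in \<open>w\<close>. The claim is
  \<open>3 * Cl'(w) \<le> n (n + 1) / 2\<close>, and the right-hand side is the sum of \<open>r(u)\<close> over the distinct
  non-empty factors \<open>u\<close>. A closed factor with longest border \<open>u\<close> is the return word of some
  occurrence of \<open>u\<close>, reaching up to the next occurrence of \<open>u\<close>. If \<open>r(u) \<ge> 2\<close>, then
  \<open>3 c(u) \<le> r(u) + e(u)\<close>, where \<open>c(u)\<close> counts the closed factors with longest border \<open>u\<close> and
  \<open>e(u)\<close> the factors that occur only once and have longest border \<open>u\<close>. Summing over \<open>u\<close> gives the
  claim, since each factor occurring once is counted in at most one \<open>e(u)\<close>.

  For the local inequality, label every occurrence of \<open>u\<close> but the last by its return word. A label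
  used at least three times pays for itself. A label used once contributes its return word to \<open>e(u)\<close>.
  Finally, two labels \<open>a\<close> and \<open>b\<close> that are each used at most twice yield a factor from an \<open>a\<close> to a
  \<open>b\<close> (or conversely) that occurs once and has longest border \<open>u\<close>; fixing \<open>a\<close> and varying \<open>b\<close>
  covers all rare labels except \<open>a\<close>, which is paid for by the last occurrence of \<open>u\<close>.
\<close>

subsection \<open>Labelled sets of positions\<close>

definition lone_points :: "nat set \<Rightarrow> (nat \<Rightarrow> 'b) \<Rightarrow> nat set" where
  "lone_points S f = {p \<in> S. \<forall>p'\<in>S. f p' = f p \<longrightarrow> p' = p}"

text \<open>In the subsequence of points labelled \<open>f p\<close> or \<open>f q\<close>, the pair
  is a single change of label. Points with other labels may lie between.\<close>

definition adjacent :: "nat set \<Rightarrow> (nat \<Rightarrow> 'b) \<Rightarrow> nat \<Rightarrow> nat \<Rightarrow> bool" where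
  "adjacent S f p q \<longleftrightarrow> p \<in> S \<and> q \<in> S \<and> p < q \<and> f p \<noteq> f q \<and>
     (\<forall>s\<in>S. p < s \<and> s < q \<longrightarrow> f s \<noteq> f p \<and> f s \<noteq> f q)"

text \<open>The change from label \<open>f p\<close> to label \<open>f q\<close> happens only once.
  Equality of the first points is a full uniqueness condition, since \<open>q'\<close> is the first
  point after \<open>p'\<close> with its label.\<close>

definition lone_pairs :: "nat set \<Rightarrow> (nat \<Rightarrow> 'b) \<Rightarrow> (nat \<times> nat) set" where
  "lone_pairs S f = {(p, q). adjacent S f p q \<and>
     (\<forall>p' q'. adjacent S f p' q' \<and> f p' = f p \<and> f q' = f q \<longrightarrow> p' = p)}"

text \<open>Allowing \<open>x = y\<close> lets labels used once and labels used twice be treated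
  alike.\<close>

lemma card_le_2_nat_set:
  fixes A :: "nat set"
  assumes "finite A" "A \<noteq> {}" "card A \<le> 2"
  obtains x y where "x \<le> y" "A = {x, y}"
proof -
  have sub: "{Min A, Max A} \<subseteq> A" using assms by simp
  have "A = {Min A, Max A}"
  proof (cases "Min A = Max A")
    case True
    then show ?thesis using assms
      by (metis Max_ge Min_le antisym insert_absorb2 insert_iff is_singletonI' is_singleton_the_elem sub
          subset_antisym subset_iff)
  next
    case False
    then have "card {Min A, Max A} = 2" by simp
    then show ?thesis using sub assms by (metis card_seteq)
  qed
  moreover have "Min A \<le> Max A" using assms by simp
  ultimately show ?thesis using that by blast
qed

text \<open>With both label classes listed, being a lone pair depends only on the relative order of
  at most four numbers, which simplification can decide.\<close>

lemma lone_pairI: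
  assumes a: "\<And>s. s \<in> S \<and> f s = a \<longleftrightarrow> s = a1 \<or> s = a2"
    and b: "\<And>s. s \<in> S \<and> f s = b \<longleftrightarrow> s = b1 \<or> s = b2"
    and "a \<noteq> b" and "p \<in> {a1, a2}" "q \<in> {b1, b2}" "p < q"
    and gap: "\<forall>s\<in>{a1, a2, b1, b2}. \<not> (p < s \<and> s < q)"
    and unique: "\<forall>p'\<in>{a1, a2}. \<forall>q'\<in>{b1, b2}. p' < q' \<longrightarrow>
       (\<forall>s\<in>{a1, a2, b1, b2}. \<not> (p' < s \<and> s < q')) \<longrightarrow> p' = p"
  shows "(p, q) \<in> lone_pairs S f" "{f p, f q} = {a, b}"
proof -
  have pq: "f p = a" "f q = b" "p \<in> S" "q \<in> S" using assms(4,5) a b by blast+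
  then show "{f p, f q} = {a, b}" by simp
  have "adjacent S f p q"
    unfolding adjacent_def pq using pq(3,4) assms(3,6) gap a b by blast
  moreover have "p' = p" if h: "adjacent S f p' q'" "f p' = a" "f q' = b" for p' q'
  proof -
    have "p' \<in> {a1, a2}" "q' \<in> {b1, b2}" "p' < q'"
      using h a b unfolding adjacent_def by blast+
    moreover have "\<forall>s\<in>{a1, a2, b1, b2}. \<not> (p' < s \<and> s < q')"
      using h a b unfolding adjacent_def by blast
    ultimately show ?thesis using unique by blast
  qed
  ultimately show "(p, q) \<in> lone_pairs S f"
    using pq(1,2) unfolding lone_pairs_def by blast
qed

text \<open>Restricted to the points labelled \<open>a\<close> or \<open>b\<close>, the label changes at most three times,
  in alternating directions, so one direction of change occurs exactly once.\<close>

lemma lone_pair_exists: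
  assumes A: "{p \<in> S. f p = a} = {a1, a2}" "a1 \<le> a2"
    and B: "{p \<in> S. f p = b} = {b1, b2}" "b1 \<le> b2" and "a \<noteq> b"
  shows "\<exists>(p, q) \<in> lone_pairs S f. {f p, f q} = {a, b}"
proof -
  have a: "s \<in> S \<and> f s = a \<longleftrightarrow> s = a1 \<or> s = a2" for s using A by blast
  have b: "s \<in> S \<and> f s = b \<longleftrightarrow> s = b1 \<or> s = b2" for s using B by blast
  have ne: "a1 \<noteq> b1" "a1 \<noteq> b2" "a2 \<noteq> b1" "a2 \<noteq> b2"
    using a[of a1] a[of a2] b[of a1] b[of a2] \<open>a \<noteq> b\<close> by auto
  note ab = lone_pairI[OF a b \<open>a \<noteq> b\<close>]
  note ba = lone_pairI[OF b a \<open>a \<noteq> b\<close>[symmetric]]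
  \<comment> \<open>The patterns are aabb, bbaa, abab, abba, baba, baab, in this order. In abba and
    baab each direction of change occurs once, so either would do.\<close>
  consider "a2 < b1" | "b2 < a1" | "a1 < b1" "b1 < a2" "a2 < b2" | "a1 < b1" "b1 < a2" "b2 < a2"
    | "b1 < a1" "a1 < b2" "b2 < a2" | "b1 < a1" "a1 < b2" "a2 < b2"
    using ne A(2) B(2) by linarith
  then show ?thesis
  proof cases
    case 1
    have "(a2, b1) \<in> lone_pairs S f" "{f a2, f b1} = {a, b}"
      using ab[of a2 b1] 1 A(2) B(2) by (simp_all)
    then show ?thesis by blast
  next
    case 2
    have "(b2, a1) \<in> lone_pairs S f" "{f b2, f a1} = {a, b}"
      using ba[of b2 a1] 2 A(2) B(2) by (simp_all add: insert_commute)
    then show ?thesis by blast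
  next
    case 3
    have "(b1, a2) \<in> lone_pairs S f" "{f b1, f a2} = {a, b}"
      using ba[of b1 a2] 3 A(2) B(2) by (simp_all add: insert_commute)
    then show ?thesis by blast
  next
    case 4
    have "(b2, a2) \<in> lone_pairs S f" "{f b2, f a2} = {a, b}"
      using ba[of b2 a2] 4 A(2) B(2) by (simp_all add: insert_commute)
    then show ?thesis by blast
  next
    case 5
    have "(a1, b2) \<in> lone_pairs S f" "{f a1, f b2} = {a, b}"
      using ab[of a1 b2] 5 A(2) B(2) by (simp_all)
    then show ?thesis by blast
  next
    case 6
    have "(a2, b2) \<in> lone_pairs S f" "{f a2, f b2} = {a, b}"
      using ab[of a2 b2] 6 A(2) B(2) by (simp_all)
    then show ?thesis by blast
  qed
qed

text \<open>The summand 1 pays for the one rare label that is held fixed. In the application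
  \<open>S\<close> omits the last occurrence of \<open>u\<close>, so \<open>card S + 1\<close> is
  the number of occurrences.\<close>

lemma label_count_bound:
  fixes f :: "nat \<Rightarrow> 'b"
  assumes "finite S"
  shows "3 * card (f ` S) \<le> card S + 1 + card (lone_points S f) + card (lone_pairs S f)"
proof -
  let ?n = "\<lambda>v. card {p \<in> S. f p = v}"
  define R where "R = {v \<in> f ` S. ?n v \<le> 2}"
  have finR: "finite R" using assms by (simp add: R_def)
  have fin_lp: "finite (lone_pairs S f)"
  proof (rule finite_subset)
    show "lone_pairs S f \<subseteq> S \<times> S" unfolding lone_pairs_def adjacent_def by blast
  qed (use assms in simp)
  have S: "card S = (\<Sum>v\<in>f ` S. ?n v)"
    using sum.image_gen[OF assms, of "\<lambda>_. 1::nat" f] by simp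
  have "(\<Sum>v\<in>f ` S. if ?n v = 1 then 1 else 0) = card {v \<in> f ` S. ?n v = 1}"
    using assms by (simp flip: sum.inter_filter)
  also have "\<dots> \<le> card (f ` lone_points S f)"
  proof (rule card_mono)
    show "finite (f ` lone_points S f)" using assms by (simp add: lone_points_def)
    show "{v \<in> f ` S. ?n v = 1} \<subseteq> f ` lone_points S f"
    proof
      fix v assume "v \<in> {v \<in> f ` S. ?n v = 1}"
      then obtain p where "{p \<in> S. f p = v} = {p}" by (elim CollectE conjE card_1_singletonE)
      then have p: "p \<in> S" "f p = v" and "\<forall>x\<in>S. f x = v \<longrightarrow> x = p" by blast+
      then have "p \<in> lone_points S f" using p unfolding lone_points_def by blast
      then show "v \<in> f ` lone_points S f" using p(2) by blast
    qed
  qed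
  also have "\<dots> \<le> card (lone_points S f)"
    by (rule card_image_le) (use assms in \<open>simp add: lone_points_def\<close>)
  finally have lone: "(\<Sum>v\<in>f ` S. if ?n v = 1 then 1 else 0) \<le> card (lone_points S f)" .
  have R: "card R = (\<Sum>v\<in>f ` S. if ?n v \<le> 2 then 1 else 0)"
    using assms by (simp add: R_def flip: sum.inter_filter)
  have "3 * card (f ` S) = (\<Sum>v\<in>f ` S. 3)" by simp
  \<comment> \<open>A label used once gives 1 + 1 + 1, one used twice gives 2 + 0 + 1, and any other
    at least 3.\<close>
  also have "\<dots> \<le> (\<Sum>v\<in>f ` S. ?n v + (if ?n v = 1 then 1 else 0) + (if ?n v \<le> 2 then 1 else 0))"
  proof (rule sum_mono)
    fix v assume "v \<in> f ` S"
    then have "{p \<in> S. f p = v} \<noteq> {}" by blast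
    then have "?n v \<noteq> 0" using assms by simp
    then show "3 \<le> ?n v + (if ?n v = 1 then 1 else 0) + (if ?n v \<le> 2 then 1 else 0)" by auto
  qed
  finally have main: "3 * card (f ` S) \<le> card S + card (lone_points S f) + card R"
    using lone unfolding S R sum.distrib by linarith
  have "card R \<le> card (lone_pairs S f) + 1"
  proof (cases "R = {}")
    case False
    then obtain a where a: "a \<in> R" by blast
    have two: "\<exists>x y. x \<le> y \<and> {p \<in> S. f p = v} = {x, y}" if "v \<in> R" for v
      by (rule card_le_2_nat_set[of "{p \<in> S. f p = v}"]) (use that assms in \<open>auto simp: R_def\<close>)
    let ?g = "\<lambda>(p, q). {f p, f q}"
    \<comment> \<open>The direction of the lone pair is not known, so unordered pairs of labels are
      compared. For fixed \<open>a\<close> they still determine \<open>b\<close>.\<close>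
    have "(\<lambda>b. {a, b}) ` (R - {a}) \<subseteq> ?g ` lone_pairs S f"
    proof (rule image_subsetI)
      fix b assume b: "b \<in> R - {a}"
      obtain a1 a2 where A: "{p \<in> S. f p = a} = {a1, a2}" "a1 \<le> a2" using two a by blast
      obtain b1 b2 where B: "{p \<in> S. f p = b} = {b1, b2}" "b1 \<le> b2" using two b by blast
      from lone_pair_exists[OF A B] b show "{a, b} \<in> ?g ` lone_pairs S f" by force
    qed
    then have "card ((\<lambda>b. {a, b}) ` (R - {a})) \<le> card (lone_pairs S f)"
      using surj_card_le[OF fin_lp] by blast
    moreover have "inj_on (\<lambda>b. {a, b}) (R - {a})" by (auto simp: inj_on_def doubleton_eq_iff)
    ultimately have "card (R - {a}) \<le> card (lone_pairs S f)" by (simp add: card_image)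
    then show ?thesis using a finR by (simp add: card_Diff_singleton)
  qed simp
  with main show ?thesis by linarith
qed

subsection \<open>Occurrences and return words\<close>

lemma occurrences_factor:
  assumes "d + length u \<le> L" "p + L \<le> length w"
  shows "d \<in> occurrences u (take L (drop p w)) \<longleftrightarrow> p + d \<in> occurrences u w"
  using assms by (auto simp: occurrences_def drop_take take_take min_def add.commute)

lemma occurrence_take_drop: "p + L \<le> length w \<Longrightarrow> p \<in> occurrences (take L (drop p w)) w"
  by (simp add: occurrences_def)

lemma finite_occurrences: "finite (occurrences u w)"
  by (rule finite_subset[of _ "{..length w}"]) (auto simp: occurrences_def)

lemma sublist_if_occurrence: "i \<in> occurrences u w \<Longrightarrow> sublist u w"
  unfolding occurrences_def
  by (metis (mono_tags, lifting) mem_Collect_eq sublist_drop sublist_order.order_trans sublist_take)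

lemma occurrence_if_sublist: "sublist u w \<Longrightarrow> \<exists>i. i \<in> occurrences u w"
proof -
  assume "sublist u w"
  then obtain ps ss where "w = ps @ u @ ss" by (auto simp: sublist_def)
  then have "length ps \<in> occurrences u w" by (simp add: occurrences_def)
  then show ?thesis by blast
qed

section \<open>Return words and their translation between copies of a factor\<close>

definition next_point :: "nat set \<Rightarrow> nat \<Rightarrow> nat" where
  "next_point S p = (LEAST s. s \<in> S \<and> p < s)"

lemma next_point:
  assumes "t \<in> S" "p < t"
  shows "next_point S p \<in> S" "p < next_point S p" "next_point S p \<le> t"
  unfolding next_point_def
  using LeastI[of "\<lambda>s. s \<in> S \<and> p < s" t] Least_le[of "\<lambda>s. s \<in> S \<and> p < s" t] assms by auto

lemma next_pointI:
  assumes "t \<in> S" "p < t" "\<And>s. s \<in> S \<Longrightarrow> p < s \<Longrightarrow> t \<le> s"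
  shows "next_point S p = t"
  unfolding next_point_def by (rule Least_equality) (use assms in auto)

text \<open>Meant for occurrences of \<open>u\<close> at \<open>p\<close> and \<open>q\<close>: the
  factor runs from the start of the first to the end of the second.\<close>

definition factor_between :: "'a list \<Rightarrow> 'a list \<Rightarrow> nat \<Rightarrow> nat \<Rightarrow> 'a list" where
  "factor_between u w p q = take (q + length u - p) (drop p w)"

definition return_word :: "'a list \<Rightarrow> 'a list \<Rightarrow> nat \<Rightarrow> 'a list" where
  "return_word u w p = factor_between u w p (next_point (occurrences u w) p)"

lemma occurrence_bound: "p \<in> occurrences u w \<Longrightarrow> p + length u \<le> length w"
  by (simp add: occurrences_def)

lemma length_factor_between:
  "q \<in> occurrences u w \<Longrightarrow> p \<le> q \<Longrightarrow> length (factor_between u w p q) = q - p + length u"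
  using occurrence_bound[of q u w] by (simp add: factor_between_def)

lemma occurrences_factor_between:
  assumes "q \<in> occurrences u w" "p \<le> q" "d \<le> q - p"
  shows "d \<in> occurrences u (factor_between u w p q) \<longleftrightarrow> p + d \<in> occurrences u w"
  unfolding factor_between_def using assms occurrence_bound[OF assms(1)]
  by (intro occurrences_factor) auto

lemma occurrence_of_factor_between:
  assumes q: "q \<in> occurrences u w" "p \<le> q" and i: "i \<in> occurrences (factor_between u w p q) w"
  shows "i + (q - p) + length u \<le> length w"
    and "take (q - p + length u) (drop i w) = take (q - p + length u) (drop p w)"
proof -
  have len: "length (factor_between u w p q) = q - p + length u" using q by (rule length_factor_between)
  show "i + (q - p) + length u \<le> length w" using occurrence_bound[OF i] len by simp
  have "take (length (factor_between u w p q)) (drop i w) = factor_between u w p q"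
    using i by (simp add: occurrences_def)
  moreover have "q - p + length u = q + length u - p" using q(2) by simp
  ultimately show "take (q - p + length u) (drop i w) = take (q - p + length u) (drop p w)"
    unfolding len by (simp add: factor_between_def)
qed

text \<open>For \<open>d \<le> q - p\<close> a copy of \<open>u\<close> at offset \<open>d\<close>
  fits inside the factor, so its presence can be read off the factor, wherever that sits in
  \<open>w\<close>.\<close>

lemma occurrence_shift:
  assumes q: "q \<in> occurrences u w" "p \<le> q" and i: "i \<in> occurrences (factor_between u w p q) w"
    and d: "d \<le> q - p"
  shows "i + d \<in> occurrences u w \<longleftrightarrow> p + d \<in> occurrences u w"
proof -
  let ?L = "q - p + length u"
  have "p + ?L \<le> length w" using occurrence_bound[OF q(1)] q(2) by simp
  then have "p + d \<in> occurrences u w \<longleftrightarrow> d \<in> occurrences u (take ?L (drop p w))"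
    using d by (intro occurrences_factor[symmetric]) auto
  moreover have "i + d \<in> occurrences u w \<longleftrightarrow> d \<in> occurrences u (take ?L (drop i w))"
    using d occurrence_of_factor_between(1)[OF q i] by (intro occurrences_factor[symmetric]) auto
  ultimately show ?thesis using occurrence_of_factor_between(2)[OF q i] by simp
qed

lemma factor_between_shift:
  assumes q: "q \<in> occurrences u w" "p \<le> q" and i: "i \<in> occurrences (factor_between u w p q) w"
    and d: "d \<le> d'" "d' \<le> q - p"
  shows "factor_between u w (i + d) (i + d') = factor_between u w (p + d) (p + d')"
proof -
  have "factor_between u w (x + d) (x + d') =
      take (d' - d + length u) (drop d (take (q - p + length u) (drop x w)))" for x
    using d by (simp add: factor_between_def drop_take take_take min_def add.commute)
  then show ?thesis using occurrence_of_factor_between(2)[OF q i] by simp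
qed

text \<open>As \<open>d\<close> is strictly below \<open>q - p\<close>, the occurrence at
  \<open>q\<close> forces the next one after \<open>p + d\<close> to lie inside the factor, and the
  whole return word is translated.\<close>

lemma return_word_shift:
  assumes q: "q \<in> occurrences u w" "p \<le> q" and i: "i \<in> occurrences (factor_between u w p q) w"
    and d: "d < q - p"
  shows "return_word u w (i + d) = return_word u w (p + d)"
proof -
  let ?O = "occurrences u w"
  let ?t = "next_point ?O (p + d)"
  have t: "?t \<in> ?O" "p + d < ?t" "?t \<le> q" using next_point[of q ?O "p + d"] q d by auto
  have "next_point ?O (i + d) = i + (?t - p)"
  proof (rule next_pointI)
    show "i + (?t - p) \<in> ?O" using occurrence_shift[OF q i, of "?t - p"] t by simp
    show "i + d < i + (?t - p)" using t by simp
    fix s assume s: "s \<in> ?O" "i + d < s"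
    show "i + (?t - p) \<le> s"
    proof (rule ccontr)
      assume "\<not> i + (?t - p) \<le> s"
      then have "s - i < ?t - p" using s by auto
      then have "p + (s - i) \<in> ?O" "p + d < p + (s - i)"
        using occurrence_shift[OF q i, of "s - i"] s t by auto
      then have "?t \<le> p + (s - i)" by (rule next_point(3))
      then show False using \<open>s - i < ?t - p\<close> by simp
    qed
  qed
  then show ?thesis unfolding return_word_def
    using factor_between_shift[OF q i, of d "?t - p"] t by simp
qed

text \<open>A border longer than \<open>u\<close> would start at \<open>p\<close> and again at some
  later occurrence of \<open>u\<close> not beyond \<open>q\<close>. Both copies contain a full
  return word, so these two positions would share a label, against \<open>first\<close>.\<close>

lemma longest_border_factor_between:
  assumes p: "p \<in> occurrences u w" and q: "q \<in> occurrences u w" "p \<le> q"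
    and r: "r \<in> occurrences u w" "q < r"
    and first: "\<And>s. s \<in> occurrences u w \<Longrightarrow> p < s \<Longrightarrow> s \<le> q \<Longrightarrow> return_word u w s \<noteq> return_word u w p"
  shows "longest_border u (factor_between u w p (next_point (occurrences u w) q))"
proof -
  let ?O = "occurrences u w"
  define e where "e = next_point ?O q"
  let ?Y = "factor_between u w p e"
  have e: "e \<in> ?O" "q < e" using next_point[OF r] by (simp_all add: e_def)
  have pe: "p \<le> e" using e q by simp
  have len: "length ?Y = e - p + length u" using e pe by (intro length_factor_between)
  have "0 \<in> occurrences u ?Y" "e - p \<in> occurrences u ?Y"
    using occurrences_factor_between[OF e(1) pe, of 0] occurrences_factor_between[OF e(1) pe, of "e - p"] p e pe by auto
  then have uY: "take (length u) ?Y = u" "drop (e - p) ?Y = u"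
    using len by (simp_all add: occurrences_def)
  then have "prefix u ?Y" "suffix u ?Y" by (metis take_is_prefix, metis suffix_drop)
  moreover have "u \<noteq> ?Y" using len e(2) q(2) by auto
  ultimately have "border u ?Y" by (simp add: border_def strict_prefix_def)
  moreover have "length x \<le> length u" if x: "border x ?Y" for x
  proof (rule ccontr)
    assume long: "\<not> length x \<le> length u"
    define m where "m = length x - length u"
    have "length x < length ?Y" using x by (simp add: border_def prefix_length_less)
    then have m: "0 < m" "m < e - p" "length x = m + length u" using long len by (auto simp: m_def)
    \<comment> \<open>This is where the copy of \<open>x\<close> that ends \<open>?Y\<close> starts
      in \<open>w\<close>.\<close>
    let ?i = "e - m"
    have "prefix x ?Y" "suffix x ?Y" using x by (auto simp: border_def)
    then have x1: "take (length x) ?Y = x" and "drop (length ?Y - length x) ?Y = x"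
      by (metis append_eq_conv_conj prefix_def, auto simp: suffix_def)
    then have x2: "drop (e - p - m) ?Y = x" using m(3) len by simp
    have "m + length u \<le> e + length u - p" using m(2) by linarith
    then have sx: "factor_between u w p (p + m) = x"
      using x1 unfolding m(3)
      by (simp add: factor_between_def min_absorb1 add.commute)
    have "take (length x) (drop ?i w) = drop (e - p - m) ?Y"
      using m q e unfolding factor_between_def by (simp add: drop_take add.commute)
    then have "?i \<in> occurrences x w"
      using x2 m occurrence_bound[OF e(1)] by (simp add: occurrences_def)
    then have i: "?i \<in> occurrences (factor_between u w p (p + m)) w" by (simp add: sx)
    \<comment> \<open>Both are suffixes of \<open>?Y\<close>, so \<open>x\<close> ends in
      \<open>u\<close>. In the prefix copy of \<open>x\<close> this gives the occurrence of
      \<open>u\<close> at \<open>p + m\<close> that the shift lemmas require.\<close>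
    have "drop m x = u" using uY(2) x2 m by (metis drop_drop le_add_diff_inverse less_imp_le_nat)
    then have "m \<in> occurrences u x" using m by (simp add: occurrences_def)
    then have "m \<in> occurrences u (take (length x) (drop 0 ?Y))" using x1 by simp
    then have "m \<in> occurrences u ?Y"
      using occurrences_factor[of m u "length x" 0 ?Y] m len by simp
    then have pm: "p + m \<in> ?O" using occurrences_factor_between[OF e(1) pe, of m] m by simp
    have "?i \<in> ?O" using occurrence_shift[OF pm _ i, of 0] p by simp
    moreover have "?i \<le> q"
    proof (rule ccontr)
      assume "\<not> ?i \<le> q"
      then have "e \<le> ?i" using next_point(3)[of ?i ?O q] calculation by (simp flip: e_def)
      then show False using m by simp
    qed
    moreover have "p < ?i" using m by simp
    moreover have "return_word u w ?i = return_word u w p"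
      using return_word_shift[OF pm _ i, of 0] m by simp
    ultimately show False using first by blast
  qed
  ultimately show ?thesis unfolding longest_border_def e_def by blast
qed

section \<open>Borders and closed factors as return words\<close>

lemma longest_border_unique: "longest_border u v \<Longrightarrow> longest_border u' v \<Longrightarrow> u = u'"
  unfolding longest_border_def border_def strict_prefix_def
  by (metis append_eq_conv_conj dual_order.antisym prefix_def)

lemma border_occurrences:
  assumes "border u v"
  shows "length u < length v" "0 \<in> occurrences u v" "length v - length u \<in> occurrences u v"
proof -
  have b: "prefix u v" "suffix u v" and len: "length u < length v"
    using assms by (auto simp: border_def prefix_length_less)
  show "length u < length v" by (fact len)
  have "take (length u) v = u" using b(1) by (auto simp: prefix_def)
  then show "0 \<in> occurrences u v" using len by (simp add: occurrences_def)
  have "drop (length v - length u) v = u" using b(2) by (auto simp: suffix_def)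
  then show "length v - length u \<in> occurrences u v" using len by (simp add: occurrences_def)
qed

lemma card_occurrences_border:
  assumes "border u v" "i \<in> occurrences v w"
  shows "2 \<le> card (occurrences u w)"
proof -
  note b = border_occurrences[OF assms(1)]
  have v: "i + length v \<le> length w" "take (length v) (drop i w) = v"
    using assms(2) by (auto simp: occurrences_def)
  then have "i + 0 \<in> occurrences u w" "i + (length v - length u) \<in> occurrences u w"
    using b
      occurrences_factor[of 0 u "length v" i w]
      occurrences_factor[of "length v - length u" u "length v" i w] by simp_all
  then have "card {i, i + (length v - length u)} \<le> card (occurrences u w)"
    by (intro card_mono finite_occurrences) auto
  then show ?thesis using b(1) by simp
qed

text \<open>The last occurrence has no next one, hence no return word. If \<open>u\<close> does not
  occur, \<open>Max\<close> is unspecified but the difference is empty anyway.\<close>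

definition return_points :: "'a list \<Rightarrow> 'a list \<Rightarrow> nat set" where
  "return_points u w = occurrences u w - {Max (occurrences u w)}"

lemma return_pointsI:
  "p \<in> occurrences u w \<Longrightarrow> q \<in> occurrences u w \<Longrightarrow> p < q \<Longrightarrow> p \<in> return_points u w"
  unfolding return_points_def using Max_ge[OF finite_occurrences, of q u w] by auto

lemma return_pointsD:
  assumes "p \<in> return_points u w"
  shows "p \<in> occurrences u w" "next_point (occurrences u w) p \<in> occurrences u w"
    "p < next_point (occurrences u w) p"
proof -
  show p: "p \<in> occurrences u w" using assms by (simp add: return_points_def)
  have "Max (occurrences u w) \<in> occurrences u w"
    using Max_in[OF finite_occurrences] p by blast
  moreover have "p < Max (occurrences u w)"
    using assms Max_ge[OF finite_occurrences p] by (auto simp: return_points_def order.strict_iff_order)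
  ultimately show "next_point (occurrences u w) p \<in> occurrences u w"
    "p < next_point (occurrences u w) p" using next_point by blast+
qed

lemma card_return_points:
  "occurrences u w \<noteq> {} \<Longrightarrow> card (return_points u w) + 1 = card (occurrences u w)"
  unfolding return_points_def using finite_occurrences[of u w]
  by (simp add: card_Diff_singleton card_gt_0_iff Suc_leI)

text \<open>The prefix and suffix copies of \<open>u\<close> are already two occurrences, so
  \<open>v\<close> contains no third, and in \<open>w\<close> the suffix copy is the next occurrence
  after the prefix copy.\<close>

lemma closed_word_is_return_word:
  assumes "sublist v w" "closed_word v" "2 \<le> length v" "longest_border u v"
  shows "v \<in> return_word u w ` return_points u w"
proof -
  have bo: "border u v" using assms(4) by (simp add: longest_border_def)
  obtain u' where "longest_border u' v" and c': "card (occurrences u' v) = 2"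
    using assms(2,3) by (auto simp: closed_word_def)
  then have "u' = u" using assms(4) longest_border_unique by blast
  with c' have card2: "card (occurrences u v) = 2" by simp
  obtain i where i: "i \<in> occurrences v w" using occurrence_if_sublist[OF assms(1)] by blast
  have v: "i + length v \<le> length w" "take (length v) (drop i w) = v"
    using i by (auto simp: occurrences_def)
  define m where "m = length v - length u"
  have "0 \<in> occurrences u v" "m \<in> occurrences u v"
    using border_occurrences[OF bo] by (simp_all add: m_def)
  moreover have m: "0 < m" "length v = m + length u"
    using border_occurrences(1)[OF bo] by (auto simp: m_def)
  ultimately have O: "occurrences u v = {0, m}"
    using card_seteq[OF finite_occurrences[of u v], of "{0, m}"] card2 by simp
  have shift: "d \<in> occurrences u v \<longleftrightarrow> i + d \<in> occurrences u w" if "d \<le> m" for d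
    using occurrences_factor[of d u "length v" i w] that m v by simp
  have im: "i \<in> occurrences u w" "i + m \<in> occurrences u w" using shift[of 0] shift[of m] O by auto
  have "next_point (occurrences u w) i = i + m"
  proof (rule next_pointI)
    fix s assume s: "s \<in> occurrences u w" "i < s"
    show "i + m \<le> s"
    proof (rule ccontr)
      assume "\<not> i + m \<le> s"
      then have "s - i \<in> occurrences u v" using shift[of "s - i"] s by simp
      then show False using O s \<open>\<not> i + m \<le> s\<close> by auto
    qed
  qed (use im m in auto)
  then have "return_word u w i = v" using v m by (simp add: return_word_def factor_between_def add.commute)
  moreover have "i \<in> return_points u w" using m by (intro return_pointsI[OF im]) simp
  ultimately show ?thesis by blast
qed

text \<open>Another occurrence of \<open>Y\<close> would carry along all occurrences of \<open>u\<close> in it and their return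
  words, hence another lone point or pair with the same labels.\<close>

lemma lone_factor:
  fixes u w :: "'a list"
  defines "S \<equiv> return_points u w" and "f \<equiv> return_word u w"
  assumes pq: "p = q \<and> p \<in> lone_points S f \<or> (p, q) \<in> lone_pairs S f"
  defines "Y \<equiv> factor_between u w p (next_point (occurrences u w) q)"
  shows "longest_border u Y" "occurrences Y w = {p}"
proof -
  let ?O = "occurrences u w"
  define e where "e = next_point ?O q"
  have pqS: "p \<in> S" "q \<in> S" "p \<le> q"
    using pq by (auto simp: lone_points_def lone_pairs_def adjacent_def)
  have O: "p \<in> ?O" "q \<in> ?O" "e \<in> ?O" "q < e" "p \<le> e"
    using pqS return_pointsD[of _ u w] unfolding S_def e_def by fastforce+
  \<comment> \<open>Strictly between \<open>p\<close> and \<open>q\<close> adjacency excludes the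
    label \<open>f p\<close>, and at \<open>q\<close> the label differs. For a lone point the range
    is empty.\<close>
  have first: "f s \<noteq> f p" if "s \<in> ?O" "p < s" "s \<le> q" for s
  proof -
    have "s \<in> S" unfolding S_def by (rule return_pointsI[of _ _ _ e]) (use that O in auto)
    then show ?thesis using pq that unfolding lone_points_def lone_pairs_def adjacent_def
      by (cases "s = q") auto
  qed
  show "longest_border u Y" unfolding Y_def
    by (rule longest_border_factor_between[OF O(1,2) pqS(3) O(3,4)]) (use first in \<open>simp add: f_def\<close>)
  have "i = p" if "i \<in> occurrences Y w" for i
  proof -
    have i: "i \<in> occurrences (factor_between u w p e) w" using that by (simp add: Y_def e_def)
    note occ = occurrence_shift[OF O(3,5) i]
    \<comment> \<open>\<open>Y\<close> reaches to the end of the occurrence at \<open>e\<close>, so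
      the return word at \<open>q\<close> is translated too.\<close>
    have f: "f (i + d) = f (p + d)" if "d < e - p" for d
      unfolding f_def using that by (rule return_word_shift[OF O(3,5) i])
    define j where "j = i + (q - p)"
    have ioe: "i \<in> ?O" "j \<in> ?O" "i + (e - p) \<in> ?O"
      using occ[of 0] occ[of "q - p"] occ[of "e - p"] O pqS by (auto simp: j_def)
    have ijS: "i \<in> S" "j \<in> S" unfolding S_def
      using ioe O pqS by (auto intro!: return_pointsI[of _ _ _ "i + (e - p)"] simp: j_def)
    have fi: "f i = f p" "f j = f q" using f[of 0] f[of "q - p"] O pqS by (auto simp: j_def)
    from pq show ?thesis
    proof
      assume "p = q \<and> p \<in> lone_points S f"
      then show ?thesis using fi ijS unfolding lone_points_def by blast
    next
      assume lp: "(p, q) \<in> lone_pairs S f"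
      have adj: "adjacent S f p q" using lp by (simp add: lone_pairs_def)
      have "adjacent S f i j"
        unfolding adjacent_def fi
      proof (intro conjI ballI impI ijS)
        show "i < j" "f p \<noteq> f q" using adj by (auto simp: adjacent_def j_def)
        fix s assume s: "s \<in> S" "i < s \<and> s < j"
        \<comment> \<open>Translating \<open>s\<close> back into the original copy puts it between
          \<open>p\<close> and \<open>q\<close>, where adjacency applies.\<close>
        define t where "t = p + (s - i)"
        have t: "p < t" "t < q" "s - i < e - p" using s O by (auto simp: t_def j_def)
        have "t \<in> ?O" using occ[of "s - i"] s t by (simp add: t_def S_def return_points_def)
        then have "t \<in> S" unfolding S_def using t O by (intro return_pointsI[of _ _ _ q]) auto
        then have "f t \<noteq> f p" "f t \<noteq> f q" using adj t by (auto simp: adjacent_def)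
        moreover have "f s = f t" using f[of "s - i"] t s by (simp add: t_def)
        ultimately show "f s \<noteq> f p" "f s \<noteq> f q" by simp_all
      qed
      then show ?thesis using lp fi unfolding lone_pairs_def by blast
    qed
  qed
  moreover have "p \<in> occurrences Y w"
    unfolding Y_def factor_between_def e_def[symmetric]
    by (rule occurrence_take_drop) (use occurrence_bound[OF O(3)] O(5) in simp)
  ultimately show "occurrences Y w = {p}" by blast
qed

subsection \<open>Counting\<close>

definition closed_with_border :: "'a list \<Rightarrow> 'a list \<Rightarrow> 'a list set" where
  "closed_with_border w u = {v. sublist v w \<and> 2 \<le> length v \<and> closed_word v \<and> longest_border u v}"

definition lone_with_border :: "'a list \<Rightarrow> 'a list \<Rightarrow> 'a list set" where
  "lone_with_border w u = {y. longest_border u y \<and> card (occurrences y w) = 1}"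

lemma finite_factors: "finite {v. sublist v w}"
  by (metis finite_set set_sublists_eq)

lemma sublist_if_card_occurrences: "card (occurrences y w) \<noteq> 0 \<Longrightarrow> sublist y w"
  by (metis all_not_in_conv card.empty sublist_if_occurrence)

lemma card_closed_with_border:
  assumes "occurrences u w \<noteq> {}"
  shows "3 * card (closed_with_border w u) \<le> card (occurrences u w) + card (lone_with_border w u)"
proof -
  let ?S = "return_points u w" and ?f = "return_word u w"
  \<comment> \<open>Lone points become diagonal pairs, so one map handles both kinds. The two parts
    are disjoint because adjacency demands \<open>p < q\<close>.\<close>
  define E where "E = (\<lambda>p. (p, p)) ` lone_points ?S ?f \<union> lone_pairs ?S ?f"
  let ?g = "\<lambda>(p, q). factor_between u w p (next_point (occurrences u w) q)"
  have finS: "finite ?S" by (simp add: return_points_def finite_occurrences)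
  have "closed_with_border w u \<subseteq> ?f ` ?S"
    using closed_word_is_return_word by (auto simp: closed_with_border_def)
  then have closed: "card (closed_with_border w u) \<le> card (?f ` ?S)"
    using finS by (intro card_mono) auto
  have sub: "lone_points ?S ?f \<subseteq> ?S" "lone_pairs ?S ?f \<subseteq> ?S \<times> ?S"
    unfolding lone_points_def lone_pairs_def adjacent_def by blast+
  then have fin: "finite (lone_points ?S ?f)" "finite (lone_pairs ?S ?f)"
    using finS by (auto intro: finite_subset)
  have "(\<lambda>p. (p, p)) ` lone_points ?S ?f \<inter> lone_pairs ?S ?f = {}"
    by (auto simp: lone_pairs_def adjacent_def)
  then have "card E = card (lone_points ?S ?f) + card (lone_pairs ?S ?f)"
    unfolding E_def using fin by (simp add: card_Un_disjoint card_image inj_on_def)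
  with label_count_bound[OF finS, of ?f] closed card_return_points[OF assms]
  have "3 * card (closed_with_border w u) \<le> card (occurrences u w) + card E" by simp
  moreover have "card E \<le> card (lone_with_border w u)"
  proof (rule card_inj_on_le)
    have lone: "longest_border u (?g x)" "occurrences (?g x) w = {fst x}" if "x \<in> E" for x
      using that lone_factor[of "fst x" "snd x" u w] by (auto simp: E_def case_prod_beta)
    then show "?g ` E \<subseteq> lone_with_border w u" by (auto simp: lone_with_border_def)
    have S: "fst x \<le> snd x" "snd x \<in> ?S" if "x \<in> E" for x
      using that sub by (auto simp: E_def lone_pairs_def adjacent_def)
    show "inj_on ?g E"
    proof (rule inj_onI)
      fix x y assume x: "x \<in> E" and y: "y \<in> E" and eq: "?g x = ?g y"
      let ?n = "next_point (occurrences u w)"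
      \<comment> \<open>The unique occurrence of the word gives back the first component; its length
        then gives the next occurrence after the second.\<close>
      have fst: "fst x = fst y" using lone(2)[OF x] lone(2)[OF y] eq by auto
      have len: "length (?g z) = ?n (snd z) - fst z + length u" "fst z < ?n (snd z)" if "z \<in> E" for z
        using return_pointsD[OF S(2)[OF that]] S(1)[OF that] length_factor_between[of "?n (snd z)" u w "fst z"]
        by (auto simp: case_prod_beta)
      have n: "?n (snd x) = ?n (snd y)" using len[OF x] len[OF y] eq fst by simp
      \<comment> \<open>If one were smaller, its next occurrence would be at most the other, which
        lies strictly before its own next occurrence.\<close>
      have "\<not> snd x < snd y" "\<not> snd y < snd x"
        using next_point(3)[of "snd y" "occurrences u w" "snd x"]
          next_point(3)[of "snd x" "occurrences u w" "snd y"]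
          return_pointsD[OF S(2)[OF x]] return_pointsD[OF S(2)[OF y]] n by auto
      then show "x = y" using fst by (simp add: prod_eq_iff)
    qed
    have "lone_with_border w u \<subseteq> {v. sublist v w}"
      unfolding lone_with_border_def using sublist_if_card_occurrences
      by (metis (lifting) Collect_mono one_neq_zero)
    then show "finite (lone_with_border w u)" using finite_factors finite_subset by blast
  qed
  ultimately show ?thesis by linarith
qed

text \<open>An occurrence is determined by its start \<open>i\<close> and its length, and at most
  \<open>length w - i\<close> lengths are possible at \<open>i\<close>.\<close>

lemma sum_card_occurrences:
  "2 * (\<Sum>y | sublist y w \<and> y \<noteq> []. card (occurrences y w)) \<le> length w * (length w + 1)"
proof -
  let ?F = "{y. sublist y w \<and> y \<noteq> []}" and ?n = "length w"
  have fin: "finite ?F" by (rule finite_subset[OF _ finite_factors[of w]]) auto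
  have "(\<Sum>y\<in>?F. card (occurrences y w)) = card (SIGMA y:?F. occurrences y w)"
    using fin finite_occurrences by (intro card_SigmaI[symmetric]) auto
  also have "\<dots> \<le> card (SIGMA i:{..<?n}. {1..?n - i})"
  proof (rule card_inj_on_le)
    let ?h = "\<lambda>(y, i). (i, length y)"
    show "inj_on ?h (SIGMA y:?F. occurrences y w)"
      by (rule inj_on_inverseI[where g = "\<lambda>(i, l). (take l (drop i w), i)"])
        (auto simp: occurrences_def)
    show "?h ` (SIGMA y:?F. occurrences y w) \<subseteq> (SIGMA i:{..<?n}. {1..?n - i})"
    proof clarify
      fix y i assume "y \<noteq> []" "i \<in> occurrences y w"
      then have "0 < length y" and "i + length y \<le> ?n" by (simp_all add: occurrences_def)
      then have "i < ?n" "1 \<le> length y" "length y \<le> ?n - i" by linarith+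
      then show "i \<in> {..<?n} \<and> length y \<in> {1..?n - i}" by auto
    qed
  qed simp
  also have "\<dots> = (\<Sum>i<?n. ?n - i)" by simp
  finally have "2 * (\<Sum>y\<in>?F. card (occurrences y w)) \<le> 2 * (\<Sum>i<?n. ?n - i)" by simp
  also have "2 * (\<Sum>i<m. m - i) = m * (m + 1)" for m :: nat
    by (induction m) (simp_all add: sum.lessThan_Suc_shift del: sum.lessThan_Suc)
  finally show ?thesis .
qed

text \<open>A border of a factor repeats in \<open>w\<close>, so borders of closed factors lie in
  \<open>Rep\<close>. Longest borders being unique, the sets \<open>lone_with_border w u\<close> are
  disjoint subsets of \<open>One\<close>.\<close>

lemma three_Cl':
  "3 * Cl' w \<le> (\<Sum>y | sublist y w \<and> y \<noteq> []. card (occurrences y w))"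
proof -
  define F where "F = {y. sublist y w \<and> y \<noteq> []}"
  define Rep where "Rep = {u \<in> F. 2 \<le> card (occurrences u w)}"
  define One where "One = {u \<in> F. card (occurrences u w) = 1}"
  have finF: "finite F" unfolding F_def by (rule finite_subset[OF _ finite_factors[of w]]) auto
  then have fin: "finite Rep" "finite One" by (simp_all add: Rep_def One_def)
  have "{v. sublist v w \<and> 2 \<le> length v \<and> closed_word v} \<subseteq> (\<Union>u\<in>Rep. closed_with_border w u)"
  proof
    fix v assume "v \<in> {v. sublist v w \<and> 2 \<le> length v \<and> closed_word v}"
    then have v: "sublist v w" "2 \<le> length v" "closed_word v" by auto
    then obtain u where u: "longest_border u v" "u \<noteq> []" by (auto simp: closed_word_def)
    obtain i where "i \<in> occurrences v w" using occurrence_if_sublist[OF v(1)] by blast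
    then have "2 \<le> card (occurrences u w)"
      using card_occurrences_border u by (auto simp: longest_border_def)
    then have "u \<in> Rep" using u sublist_if_card_occurrences[of u w] by (simp add: Rep_def F_def)
    then show "v \<in> (\<Union>u\<in>Rep. closed_with_border w u)" using u v by (auto simp: closed_with_border_def)
  qed
  moreover have "finite (closed_with_border w u)" for u
    by (rule finite_subset[OF _ finite_factors[of w]]) (auto simp: closed_with_border_def)
  ultimately have "Cl' w \<le> card (\<Union>u\<in>Rep. closed_with_border w u)"
    unfolding Cl'_def using fin by (intro card_mono) auto
  also have "\<dots> \<le> (\<Sum>u\<in>Rep. card (closed_with_border w u))" using fin by (intro card_UN_le)
  finally have "3 * Cl' w \<le> (\<Sum>u\<in>Rep. 3 * card (closed_with_border w u))"
    by (simp flip: sum_distrib_left)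
  also have "\<dots> \<le> (\<Sum>u\<in>Rep. card (occurrences u w) + card (lone_with_border w u))"
    by (intro sum_mono card_closed_with_border) (auto simp: Rep_def)
  also have "\<dots> = (\<Sum>u\<in>Rep. card (occurrences u w)) + (\<Sum>u\<in>Rep. card (lone_with_border w u))"
    by (rule sum.distrib)
  also have "(\<Sum>u\<in>Rep. card (lone_with_border w u)) \<le> card One"
  proof -
    have sub: "lone_with_border w u \<subseteq> One" if "u \<in> Rep" for u
    proof
      fix y assume "y \<in> lone_with_border w u"
      then have y: "longest_border u y" "card (occurrences y w) = 1"
        by (auto simp: lone_with_border_def)
      then have "y \<noteq> []" by (auto simp: longest_border_def border_def)
      then show "y \<in> One" using y sublist_if_card_occurrences[of y w] by (simp add: One_def F_def)
    qed
    have "lone_with_border w u \<inter> lone_with_border w u' = {}" if "u \<noteq> u'" for u u'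
      using that longest_border_unique[of u _ u'] by (auto simp: lone_with_border_def)
    then have "(\<Sum>u\<in>Rep. card (lone_with_border w u)) = card (\<Union>u\<in>Rep. lone_with_border w u)"
      using fin finite_subset[OF sub] by (intro card_UN_disjoint[symmetric]) auto
    also have "\<dots> \<le> card One" using fin sub by (intro card_mono) auto
    finally show ?thesis .
  qed
  \<comment> \<open>Each member of \<open>One\<close> has occurrence count 1, so this term merges
    with the sum over \<open>Rep\<close>.\<close>
  also have "card One = (\<Sum>u\<in>One. card (occurrences u w))" by (simp add: One_def)
  also have "(\<Sum>u\<in>Rep. card (occurrences u w)) + \<dots> = (\<Sum>u\<in>Rep \<union> One. card (occurrences u w))"
    using fin by (intro sum.union_disjoint[symmetric]) (auto simp: Rep_def One_def)
  also have "\<dots> \<le> (\<Sum>u\<in>F. card (occurrences u w))"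
    using finF by (intro sum_mono2) (auto simp: Rep_def One_def)
  finally show ?thesis by (simp add: F_def)
qed

theorem theorem3:
  fixes A :: "'a set" and w :: "'a list" and n :: nat
  assumes "finite A" and "w \<in> lists A" and "length w = n"
  shows "real (Cl' w) \<le> (real n)\<^sup>2 / 6 + real n / 6"
proof -
  have "6 * Cl' w \<le> n * (n + 1)"
    using three_Cl'[of w] sum_card_occurrences[of w] assms(3) by simp
  then have "real (6 * Cl' w) \<le> real (n * (n + 1))" by (rule of_nat_mono)
  then show ?thesis by (simp add: power2_eq_square field_simps)
qed

end
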